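(* Let $Q$ be a real $m\times n$ matrix with $Q^TQ=I_n$, leverage scores $\ell_j=\|e_j^TQ\|_2^2$, $1\le j\le m$, and coherence $\mu=\max_{1\le j\le m}\ell_j$. Label the leverage scores in non-increasing order, $\mu=\ell_{[1]}\ge\cdots\ge\ell_{[m]}$, and set $$t\equiv\lfloor 1/\mu\rfloor,\qquad \tau\equiv\mu\sum_{j=1}^t\ell_{[j]}+(1-t\,\mu)\,\ell_{[t+1]}.$$ Let $c$ be an integer with $n\le c\le m$, let $S$ be the $c\times m$ random matrix produced by uniform sampling with replacement, and let $0<\epsilon<1$ and $0<\delta<1$. If $$c\ge\tfrac{2}{3}\,m\,(3\tau+\epsilon\mu)\,\frac{\ln(2n/\delta)}{\epsilon^2},$$ then with probability at least $1-\delta$ we have $\operatorname{rank}(SQ)=n$ and $\kappa(SQ)\le\sqrt{\frac{1+\epsilon}{1-\epsilon}}$.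
   Context: Here $e_1,\dots,e_m$ are the canonical (column) basis vectors of $\mathbb{R}^m$, $\|\cdot\|_2$ is the Euclidean two-norm (for vectors and matrices), and for a real matrix $Z$ of full column rank, $\kappa(Z)\equiv\|Z\|_2\|Z^\dagger\|_2$ is the two-norm condition number, with $Z^\dagger$ the Moore-Penrose inverse. If $t=m$ (which forces $1-t\mu=0$), the term $(1-t\mu)\,\ell_{[t+1]}$ is interpreted as $0$. Uniform sampling with replacement: let $k_1,\dots,k_c$ be independent and uniformly distributed on $\{1,\dots,m\}$, and let $S=\sqrt{m/c}\,\begin{pmatrix}e_{k_1}&\cdots&e_{k_c}\end{pmatrix}^T$, a $c\times m$ matrix. *)

theory Defs
  imports "HOL-Probability.Probability"
begin

text \<open>
  A real \<open>m \<times> n\<close> matrix has type \<open>real^'n^'m\<close>, with \<open>m = CARD('m)\<close> and \<open>n = CARD('n)\<close>; both are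
  positive because types are nonempty.
\<close>

subsection \<open>Two-norm, Moore-Penrose inverse and condition number\<close>

text \<open>The library's \<open>norm\<close> on \<open>real^'n^'m\<close> is the Frobenius norm, hence the operator norm here.\<close>
definition matrix_norm2 :: "real^'n^'m \<Rightarrow> real" where
  "matrix_norm2 A = onorm (\<lambda>x. A *v x)"

definition is_moore_penrose :: "real^'n^'m \<Rightarrow> real^'m^'n \<Rightarrow> bool" where
  "is_moore_penrose A X \<longleftrightarrow>
     A ** X ** A = A \<and> X ** A ** X = X \<and>
     transpose (A ** X) = A ** X \<and> transpose (X ** A) = X ** A"

definition moore_penrose :: "real^'n^'m \<Rightarrow> real^'m^'n" where
  "moore_penrose A = (THE X. is_moore_penrose A X)"

definition cond2 :: "real^'n^'m \<Rightarrow> real" where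
  "cond2 Z = matrix_norm2 Z * matrix_norm2 (moore_penrose Z)"

lemma is_moore_penrose_unique:
  assumes X: "is_moore_penrose A X" and Y: "is_moore_penrose A Y"
  shows "X = Y"
proof -
  have "A ** X = transpose (A ** X)"
    using X by (simp add: is_moore_penrose_def)
  also have "\<dots> = transpose ((A ** Y) ** (A ** X))"
    using Y by (simp add: is_moore_penrose_def matrix_mul_assoc)
  also have "\<dots> = (A ** X) ** (A ** Y)"
    using X Y by (simp add: is_moore_penrose_def matrix_transpose_mul)
  also have "\<dots> = A ** Y"
    using X by (simp add: is_moore_penrose_def matrix_mul_assoc)
  finally have AX: "A ** X = A ** Y" .
  have "X ** A = transpose (X ** A)"
    using X by (simp add: is_moore_penrose_def)
  also have "\<dots> = transpose ((X ** A) ** (Y ** A))"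
    using Y by (metis is_moore_penrose_def matrix_mul_assoc)
  also have "\<dots> = (Y ** A) ** (X ** A)"
    using X Y by (simp add: is_moore_penrose_def matrix_transpose_mul)
  also have "\<dots> = Y ** A"
    using X by (metis is_moore_penrose_def matrix_mul_assoc)
  finally have XA: "X ** A = Y ** A" .
  have "X = X ** (A ** X)"
    using X by (simp add: is_moore_penrose_def matrix_mul_assoc)
  also have "\<dots> = Y ** A ** Y"
    using AX XA by (simp add: matrix_mul_assoc)
  also have "\<dots> = Y"
    using Y by (simp add: is_moore_penrose_def)
  finally show ?thesis .
qed

lemma moore_penrose_eqI: "is_moore_penrose A X \<Longrightarrow> moore_penrose A = X"
  unfolding moore_penrose_def by (blast intro: is_moore_penrose_unique)

subsection \<open>Leverage scores\<close>

definition leverage :: "real^'n^'m \<Rightarrow> 'm \<Rightarrow> real" where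
  "leverage Q j = (norm (axis j 1 v* Q))\<^sup>2"

definition coherence :: "real^'n^'m \<Rightarrow> real" where
  "coherence Q = Max (range (leverage Q))"

text \<open>
  \<open>leverage_sorted Q j\<close> is the \<open>j\<close>-th largest leverage score (counted with multiplicity) for
  \<open>1 \<le> j \<le> m\<close>. The value \<open>0\<close> outside this range implements the convention for
  \<open>(1 - t \<mu>) \<ell>\<^sub>[\<^sub>t\<^sub>+\<^sub>1\<^sub>]\<close> in the case \<open>t = m\<close>.
\<close>
definition leverage_sorted :: "real^'n^'m \<Rightarrow> nat \<Rightarrow> real" where
  "leverage_sorted Q j =
     (if 1 \<le> j \<and> j \<le> CARD('m)
      then rev (sorted_list_of_multiset (image_mset (leverage Q) (mset_set UNIV))) ! (j - 1)
      else 0)"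

definition lev_t :: "real^'n^'m \<Rightarrow> nat" where
  "lev_t Q = nat \<lfloor>1 / coherence Q\<rfloor>"

definition lev_tau :: "real^'n^'m \<Rightarrow> real" where
  "lev_tau Q =
     coherence Q * (\<Sum>j = 1..lev_t Q. leverage_sorted Q j) +
     (1 - real (lev_t Q) * coherence Q) * leverage_sorted Q (lev_t Q + 1)"

subsection \<open>Uniform sampling with replacement\<close>

definition sampling_matrix :: "('c \<Rightarrow> 'm) \<Rightarrow> real^'m^'c" where
  "sampling_matrix k = sqrt (real CARD('m) / real CARD('c)) *\<^sub>R (\<chi> i. axis (k i) 1)"

text \<open>
  The random indices \<open>k i\<close>, one for each \<open>i :: 'c\<close> (so \<open>c = CARD('c)\<close>), are independent and
  uniformly distributed on the row indices \<open>'m\<close>.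
\<close>
definition uniform_sampling :: "'w measure \<Rightarrow> ('c::finite \<Rightarrow> 'w \<Rightarrow> 'm::finite) \<Rightarrow> bool" where
  "uniform_sampling M k \<longleftrightarrow>
     prob_space M \<and>
     prob_space.indep_vars M (\<lambda>_. count_space UNIV) k UNIV \<and>
     (\<forall>i. distr M (count_space UNIV) (k i) = uniform_count_measure UNIV)"

end

theory Submission
  imports Defs
begin

text \<open>
  With \<open>q\<^sub>j\<close> the rows of \<open>Q\<close>, \<open>(S Q)\<^sup>T (S Q)\<close> is a sum of \<open>c\<close> independent copies of \<open>(m/c) q q\<^sup>T\<close> with
  expectation \<open>I\<close>. The Golden-Thompson inequality bounds the expected trace of \<open>exp (s \<theta> (S Q)\<^sup>T (S Q))\<close>,
  \<open>s\<close> being 1 or -1, by \<open>n\<close> times the \<open>c\<close>-th power of the norm of the expected exponential of one summand;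
  as the summands are identically distributed, this loses nothing against the matrix Bernstein
  inequality. The variance term is \<open>(m/c) \<parallel>\<Sum>\<^sub>j \<ell>\<^sub>j q\<^sub>j q\<^sub>j\<^sup>T\<parallel> \<le> (m/c) \<tau>\<close>, because the weights \<open>(q\<^sub>j \<bullet> v)\<^sup>2\<close> of a
  unit vector \<open>v\<close> sum to 1 and are at most \<open>\<mu>\<close>.
\<close>

subsection \<open>The Banach algebra of square matrices\<close>

text \<open>
  The type \<open>real^'n^'n\<close> carries the componentwise product and the Frobenius norm. A copy with the
  matrix product and the operator norm is a Banach algebra, so that the library's \<open>exp\<close>
  becomes the matrix exponential.
\<close>

typedef 'n sqmat = "UNIV :: (real^'n::finite^'n) set"
  morphisms mat_of sqmat_of by auto

setup_lifting type_definition_sqmat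

instantiation sqmat :: (finite) real_vector
begin

lift_definition zero_sqmat :: "'a sqmat" is 0 .
lift_definition plus_sqmat :: "'a sqmat \<Rightarrow> 'a sqmat \<Rightarrow> 'a sqmat" is "(+)" .
lift_definition minus_sqmat :: "'a sqmat \<Rightarrow> 'a sqmat \<Rightarrow> 'a sqmat" is "(-)" .
lift_definition uminus_sqmat :: "'a sqmat \<Rightarrow> 'a sqmat" is "uminus" .
lift_definition scaleR_sqmat :: "real \<Rightarrow> 'a sqmat \<Rightarrow> 'a sqmat" is "scaleR" .

instance
  by (standard; transfer; simp add: algebra_simps)

end

instantiation sqmat :: (finite) real_normed_vector
begin

lift_definition norm_sqmat :: "'a sqmat \<Rightarrow> real" is "matrix_norm2" .

definition "dist A B = norm (A - B)" for A B :: "'a sqmat"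
definition "sgn A = A /\<^sub>R norm A" for A :: "'a sqmat"
definition [code del]: "(uniformity :: ('a sqmat \<times> 'a sqmat) filter) =
  (INF e\<in>{0<..}. principal {(x, y). dist x y < e})"
definition [code del]: "open U = (\<forall>x\<in>U. eventually (\<lambda>(x', y). x' = x \<longrightarrow> y \<in> U) uniformity)"
  for U :: "'a sqmat set"

instance
proof
  fix a b :: "'a sqmat" and r :: real and U :: "'a sqmat set"
  show "dist a b = norm (a - b)" "sgn a = a /\<^sub>R norm a"
    by (simp_all add: dist_sqmat_def sgn_sqmat_def)
  show "uniformity = (INF e\<in>{0<..}. principal {(x::'a sqmat, y). dist x y < e})"
    by (rule uniformity_sqmat_def)
  show "open U = (\<forall>x\<in>U. eventually (\<lambda>(x', y). x' = x \<longrightarrow> y \<in> U) uniformity)"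
    by (rule open_sqmat_def)
  show "norm a = 0 \<longleftrightarrow> a = 0"
    by transfer (simp add: matrix_norm2_def onorm_eq_0 matrix_vector_mul_bounded_linear,
        metis matrix_eq matrix_vector_mult_0)
  show "norm (a + b) \<le> norm a + norm b"
    by transfer (simp add: matrix_norm2_def matrix_vector_mult_add_rdistrib onorm_triangle)
  show "norm (r *\<^sub>R a) = \<bar>r\<bar> * norm a"
    by transfer (simp add: matrix_norm2_def onorm_scaleR flip: scaleR_matrix_vector_assoc)
qed

end

instantiation sqmat :: (finite) real_normed_algebra_1
begin

lift_definition one_sqmat :: "'a sqmat" is "mat 1" .
lift_definition times_sqmat :: "'a sqmat \<Rightarrow> 'a sqmat \<Rightarrow> 'a sqmat" is "(**)" .

instance
proof
  fix a b c :: "'a sqmat" and r :: real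
  show "a * b * c = a * (b * c)"
    by transfer (simp add: matrix_mul_assoc)
  show "(a + b) * c = a * c + b * c"
    by transfer (simp add: matrix_eq matrix_vector_mult_add_rdistrib flip: matrix_vector_mul_assoc)
  show "a * (b + c) = a * b + a * c"
    by transfer (simp add: matrix_add_ldistrib)
  show "r *\<^sub>R a * b = r *\<^sub>R (a * b)" "a * r *\<^sub>R b = r *\<^sub>R (a * b)"
    by (transfer; simp add: scalar_matrix_assoc matrix_scalar_ac)+
  show "1 * a = a" "a * 1 = a"
    by (transfer; simp)+
  show "(0::'a sqmat) \<noteq> 1"
    by transfer (auto simp: mat_def vec_eq_iff)
  show "norm (a * b) \<le> norm a * norm b"
    by transfer (use onorm_compose[OF matrix_vector_mul_bounded_linear matrix_vector_mul_bounded_linear]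
      in \<open>simp add: matrix_norm2_def o_def matrix_vector_mul_assoc\<close>)
  show "norm (1::'a sqmat) = 1"
    by transfer (simp add: matrix_norm2_def onorm_id)
qed

end

text \<open>Entries are bounded by the operator norm, which in turn is at most the sum of the
  absolute entries. So a Cauchy sequence converges entrywise, and the entrywise limit is its limit
  in norm.\<close>

instance sqmat :: (finite) banach
proof
  fix X :: "nat \<Rightarrow> 'a sqmat"
  assume X: "Cauchy X"
  have "convergent (\<lambda>n. mat_of (X n) $ i $ j)" for i j
  proof (rule Cauchy_convergent, rule metric_CauchyI)
    fix e :: real assume "e > 0"
    then obtain N where N: "\<And>m n. m \<ge> N \<Longrightarrow> n \<ge> N \<Longrightarrow> dist (X m) (X n) < e"
      using X by (metis Cauchy_def)
    have "dist (mat_of (X m) $ i $ j) (mat_of (X n) $ i $ j) < e" if "m \<ge> N" "n \<ge> N" for m n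
    proof -
      have "\<bar>mat_of (X m - X n) $ i $ j\<bar> \<le> norm (X m - X n)"
        unfolding norm_sqmat.rep_eq matrix_norm2_def by (rule matrix_component_le_onorm)
      then show ?thesis
        using N[OF that] by (simp add: dist_norm minus_sqmat.rep_eq)
    qed
    then show "\<exists>N. \<forall>m\<ge>N. \<forall>n\<ge>N. dist (mat_of (X m) $ i $ j) (mat_of (X n) $ i $ j) < e"
      by blast
  qed
  then obtain l where l: "\<And>i j. (\<lambda>n. mat_of (X n) $ i $ j) \<longlonglongrightarrow> l i j"
    unfolding convergent_def by metis
  define L where "L = sqmat_of (\<chi> i j. l i j)"
  have L: "mat_of (X n - L) $ i $ j = mat_of (X n) $ i $ j - l i j" for n i j
    by (simp add: L_def minus_sqmat.rep_eq sqmat_of_inverse)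
  have "(\<lambda>n. \<Sum>i\<in>UNIV. \<Sum>j\<in>UNIV. \<bar>mat_of (X n) $ i $ j - l i j\<bar>) \<longlonglongrightarrow> (\<Sum>i\<in>(UNIV::'a set). \<Sum>j\<in>(UNIV::'a set). \<bar>l i j - l i j\<bar>)"
    by (intro tendsto_sum tendsto_rabs tendsto_diff l tendsto_const)
  then have "(\<lambda>n. \<Sum>i\<in>UNIV. \<Sum>j\<in>UNIV. \<bar>mat_of (X n) $ i $ j - l i j\<bar>) \<longlonglongrightarrow> 0"
    by simp
  then have "(\<lambda>n. norm (X n - L)) \<longlonglongrightarrow> 0"
  proof (rule Lim_null_comparison[rotated], intro always_eventually allI)
    show "norm (norm (X n - L)) \<le> (\<Sum>i\<in>UNIV. \<Sum>j\<in>UNIV. \<bar>mat_of (X n) $ i $ j - l i j\<bar>)" for n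
      using onorm_le_matrix_component_sum[of "mat_of (X n - L)"]
      by (simp only: L norm_sqmat.rep_eq matrix_norm2_def real_norm_def)
        (simp add: onorm_pos_le matrix_vector_mul_bounded_linear)
  qed
  then have "X \<longlonglongrightarrow> L"
    by (rule LIM_zero_cancel[OF tendsto_norm_zero_cancel])
  then show "convergent X"
    by (rule convergentI)
qed

subsection \<open>Trace, transpose and action on vectors\<close>

lift_definition tr :: "'n::finite sqmat \<Rightarrow> real" is trace .
lift_definition tp :: "'n::finite sqmat \<Rightarrow> 'n sqmat" is transpose .
lift_definition app :: "'n::finite sqmat \<Rightarrow> real^'n \<Rightarrow> real^'n" is "(*v)" .

lemma app_linear_simps [simp]:
  "app 1 v = v" "app 0 v = 0" "app (A * B) v = app A (app B v)" "app (A + B) v = app A v + app B v"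
  "app (r *\<^sub>R A) v = r *\<^sub>R app A v"
  by (transfer; simp add: matrix_vector_mul_assoc matrix_vector_mult_add_rdistrib
      flip: scaleR_matrix_vector_assoc)+

lemma tp_simps [simp]:
  "tp 1 = 1" "tp (A * B) = tp B * tp A" "tp (tp A) = A" "tp (A + B) = tp A + tp B"
  "tp (r *\<^sub>R A) = r *\<^sub>R tp A"
proof -
  show "tp 1 = 1" "tp (tp A) = A"
    by (transfer; simp)+
  show "tp (A * B) = tp B * tp A"
    by transfer (rule matrix_transpose_mul)
  show "tp (A + B) = tp A + tp B" "tp (r *\<^sub>R A) = r *\<^sub>R tp A"
    by (transfer; simp add: transpose_def vec_eq_iff)+
qed

lemma tp_power: "tp (A ^ k) = tp A ^ k"
  by (induction k) (simp_all add: power_commutes)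

lemma app_tp: "app A v \<bullet> w = v \<bullet> app (tp A) w"
  by transfer (metis dot_lmul_matrix inner_commute transpose_transpose vector_transpose_matrix)

lemma norm_app_le: "norm (app A v) \<le> norm A * norm v"
  by transfer (simp add: matrix_norm2_def onorm matrix_vector_mul_bounded_linear)

lemma tr_conv_app: "tr A = (\<Sum>i\<in>UNIV. axis i 1 \<bullet> app A (axis i 1))"
  by transfer (simp add: trace_def inner_axis' matrix_vector_mult_basis column_def)

lemma tr_1: "tr (1 :: 'n::finite sqmat) = real CARD('n)"
  by (simp add: tr_conv_app inner_axis_axis)

lemma tr_mult_commute: "tr (A * B) = tr (B * A)"
  by transfer (rule trace_mul_sym)

text \<open>This is the Frobenius inner product, computed column by column.\<close>

lemma tr_tp_mult: "tr (tp A * B) = (\<Sum>i\<in>UNIV. app A (axis i 1) \<bullet> app B (axis i 1))"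
  unfolding tr_conv_app by (simp add: app_tp)

lemma bounded_linear_app: "bounded_linear (\<lambda>A. app A v)"
  by (rule bounded_linear_intro[where K="norm v"]) (simp_all add: norm_app_le)

lemma bounded_linear_tr: "bounded_linear (tr :: 'n::finite sqmat \<Rightarrow> real)"
  unfolding tr_conv_app
  by (intro bounded_linear_sum bounded_linear_inner_right[THEN bounded_linear_compose] bounded_linear_app)

lemma sqmat_eqI: "(\<And>v. app A v = app B v) \<Longrightarrow> A = B"
  by transfer (simp add: matrix_eq)

text \<open>In |A^T v|^2 = (A A^T v) . v one factor |A^T v| cancels. Continuity of \<open>tp\<close>
  lets it pass through the exponential series.\<close>

lemma bounded_linear_tp: "bounded_linear (tp :: 'n::finite sqmat \<Rightarrow> 'n sqmat)"
proof (rule bounded_linear_intro[where K=1])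
  fix A :: "'n sqmat"
  have "norm (app (tp A) v) \<le> norm A * norm v" for v
  proof (cases "app (tp A) v = 0")
    case False
    have "norm (app (tp A) v) * norm (app (tp A) v) = app A (app (tp A) v) \<bullet> v"
      by (simp add: app_tp dot_square_norm power2_eq_square)
    also have "\<dots> \<le> norm A * norm (app (tp A) v) * norm v"
      by (meson norm_cauchy_schwarz norm_app_le mult_right_mono norm_ge_zero order_trans)
    finally show ?thesis using False
      by (simp add: mult.commute mult.left_commute)
  qed simp
  then have "norm (tp A) \<le> norm A"
    unfolding norm_sqmat.rep_eq[of "tp A"] matrix_norm2_def
    by (intro onorm_le) (simp flip: app.rep_eq)
  then show "norm (tp A) \<le> norm A * 1" by simp
qed simp_all

subsection \<open>The Lie product formula and the Golden-Thompson inequality\<close>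

text \<open>Telescoping with the order of the factors kept: U^(k+1) - V^(k+1) = U (U^k - V^k) + (U -
  V) V^k.\<close>

lemma norm_power_diff_le:
  fixes U V :: "'a::real_normed_algebra_1"
  assumes "norm U \<le> r" "norm V \<le> r" "1 \<le> r"
  shows "norm (U ^ k - V ^ k) \<le> real k * r ^ k * norm (U - V)"
proof (induction k)
  case (Suc k)
  have "norm (U ^ Suc k - V ^ Suc k) = norm (U * (U ^ k - V ^ k) + (U - V) * V ^ k)"
    by (simp add: algebra_simps)
  also have "\<dots> \<le> norm U * norm (U ^ k - V ^ k) + norm (U - V) * norm V ^ k"
    by (meson add_mono norm_mult_ineq norm_power_ineq norm_triangle_ineq order_trans mult_left_mono
        norm_ge_zero)
  also have "\<dots> \<le> r * (real k * r ^ k * norm (U - V)) + norm (U - V) * r ^ Suc k"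
    using assms Suc
    by (intro add_mono mult_mono order_trans[OF power_mono power_increasing]) auto
  also have "\<dots> = real (Suc k) * r ^ Suc k * norm (U - V)"
    by (simp add: algebra_simps)
  finally show ?case .
qed simp

text \<open>The derivative of exp (t C) at t = 0 is \<open>C\<close>; here t runs through
  1/N.\<close>

lemma exp_scaled_diff_tendsto:
  fixes C :: "'a::{real_normed_algebra_1, banach}"
  assumes N: "filterlim N at_top sequentially"
  shows "(\<lambda>k. real (N k) *\<^sub>R (exp (C /\<^sub>R real (N k)) - 1)) \<longlonglongrightarrow> C"
proof -
  have pos: "\<forall>\<^sub>F k in sequentially. 0 < N k"
    using N eventually_gt_at_top[of "0::nat"] unfolding filterlim_iff by blast
  have "filterlim (\<lambda>k. inverse (real (N k))) (at 0) sequentially"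
    unfolding filterlim_at
    by (intro conjI tendsto_inverse_0_at_top filterlim_compose[OF filterlim_real_sequentially N]
        eventually_mono[OF pos]) auto
  moreover have "((\<lambda>t. norm (exp (t *\<^sub>R C) - 1 - t *\<^sub>R C) / norm t) \<longlongrightarrow> 0) (at 0)"
    using exp_scaleR_has_vector_derivative_right[of C 0 UNIV]
    by (simp add: has_vector_derivative_def has_derivative_iff_norm)
  ultimately have "(\<lambda>k. norm (exp (inverse (real (N k)) *\<^sub>R C) - 1 - inverse (real (N k)) *\<^sub>R C)
      / norm (inverse (real (N k)))) \<longlonglongrightarrow> 0"
    by (rule filterlim_compose[rotated])
  then have "(\<lambda>k. norm (real (N k) *\<^sub>R (exp (C /\<^sub>R real (N k)) - 1) - C)) \<longlonglongrightarrow> 0"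
  proof (rule Lim_transform_eventually, intro eventually_mono[OF pos])
    fix k assume k: "0 < N k"
    have "norm X / norm (inverse (real (N k))) = norm (real (N k) *\<^sub>R X)" for X :: 'a
      using k by (simp add: divide_inverse mult.commute)
    then have "norm (exp (C /\<^sub>R real (N k)) - 1 - C /\<^sub>R real (N k)) / norm (inverse (real (N k))) =
      norm (real (N k) *\<^sub>R (exp (C /\<^sub>R real (N k)) - 1 - C /\<^sub>R real (N k)))" .
    also have "real (N k) *\<^sub>R (exp (C /\<^sub>R real (N k)) - 1 - C /\<^sub>R real (N k)) =
      real (N k) *\<^sub>R (exp (C /\<^sub>R real (N k)) - 1) - C"
      using k by (simp add: algebra_simps)
    finally show "norm (exp (C /\<^sub>R real (N k)) - 1 - C /\<^sub>R real (N k)) / norm (inverse (real (N k)))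
      = norm (real (N k) *\<^sub>R (exp (C /\<^sub>R real (N k)) - 1) - C)" .
  qed
  then show ?thesis
    by (rule LIM_zero_cancel[OF tendsto_norm_zero_cancel])
qed

lemma exp_scaleR_inverse_power:
  fixes C :: "'a::{real_normed_algebra_1, banach}"
  assumes "0 < k"
  shows "exp (C /\<^sub>R real k) ^ k = exp C"
proof -
  have "exp X ^ j = exp (real j *\<^sub>R X)" for X :: 'a and j
  proof (induction j)
    case (Suc j)
    have "exp (X + real j *\<^sub>R X) = exp X * exp (real j *\<^sub>R X)"
      by (rule exp_add_commuting) simp
    then show ?case
      by (simp add: Suc algebra_simps)
  qed simp
  then show ?thesis using assms by simp
qed

text \<open>A noncommutative form of (1 + C/N)^N -> exp C. The comparison sequence exp (C/N) has
  N-th power exp C exactly, and its distance from \<open>U\<close> is o(1/N), which outweighs the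
  factor N lost in comparing the powers. It is applied to matrices and to reals.\<close>

lemma power_tendsto_exp:
  fixes U :: "nat \<Rightarrow> 'a::{real_normed_algebra_1, banach}"
  assumes U: "(\<lambda>k. real (N k) *\<^sub>R (U k - 1)) \<longlonglongrightarrow> C"
    and N: "filterlim N at_top sequentially"
  shows "(\<lambda>k. U k ^ N k) \<longlonglongrightarrow> exp C"
proof -
  define V where "V k = exp (C /\<^sub>R real (N k))" for k
  have V: "(\<lambda>k. real (N k) *\<^sub>R (V k - 1)) \<longlonglongrightarrow> C"
    unfolding V_def by (rule exp_scaled_diff_tendsto[OF N])
  have pos: "\<forall>\<^sub>F k in sequentially. 0 < N k"
    using N eventually_gt_at_top[of "0::nat"] unfolding filterlim_iff by blast
  obtain K1 where K1: "\<And>k. norm (real (N k) *\<^sub>R (U k - 1)) \<le> K1"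
    using convergent_imp_bounded[OF U] by (auto simp: bounded_iff)
  obtain K2 where K2: "\<And>k. norm (real (N k) *\<^sub>R (V k - 1)) \<le> K2"
    using convergent_imp_bounded[OF V] by (auto simp: bounded_iff)
  define K where "K = max K1 K2"
  have K: "norm W \<le> 1 + K / real k" if "norm (real k *\<^sub>R (W - 1)) \<le> K" "0 < k" for W :: 'a and k
  proof -
    have "real k * norm W \<le> real k * (1 + norm (W - 1))"
      using norm_triangle_ineq[of 1 "W - 1"] by (intro mult_left_mono) simp_all
    moreover have "real k * norm (W - 1) \<le> K"
      using that(1) by simp
    ultimately show ?thesis using that(2) by (simp add: field_simps del: mult_le_cancel_left_pos)
  qed
  have "K \<ge> 0"
    using order_trans[OF norm_ge_zero K1[of 0]] by (simp add: K_def)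
  have "\<forall>\<^sub>F k in sequentially. norm (U k ^ N k - V k ^ N k) \<le>
      exp K * norm (real (N k) *\<^sub>R (U k - 1) - real (N k) *\<^sub>R (V k - 1))"
    using pos
  proof eventually_elim
    case (elim k)
    define r where "r = 1 + K / real (N k)"
    have "norm (U k) \<le> r" "norm (V k) \<le> r"
      using K[OF _ elim] K1[of k] K2[of k] by (simp_all add: r_def K_def)
    moreover have "1 \<le> r"
      using \<open>K \<ge> 0\<close> by (simp add: r_def)
    ultimately have "norm (U k ^ N k - V k ^ N k) \<le> real (N k) * r ^ N k * norm (U k - V k)"
      by (rule norm_power_diff_le)
    also have "\<dots> = r ^ N k * (real (N k) * norm (U k - V k))"
      by simp
    \<comment> \<open>The power (1 + K/N)^N stays below exp K, uniformly in the index.\<close>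
    also have "r ^ N k \<le> exp (K / real (N k)) ^ N k"
      unfolding r_def by (rule power_mono[OF exp_ge_add_one_self]) (use \<open>1 \<le> r\<close> r_def in linarith)
    also have "exp (K / real (N k)) ^ N k = exp K"
      using exp_scaleR_inverse_power[OF elim, of K] by (simp add: divide_inverse mult.commute)
    also have "real (N k) * norm (U k - V k) = norm (real (N k) *\<^sub>R (U k - V k))"
      by simp
    also have "real (N k) *\<^sub>R (U k - V k) = real (N k) *\<^sub>R (U k - 1) - real (N k) *\<^sub>R (V k - 1)"
      by (simp add: algebra_simps)
    finally show ?case by (simp add: mult_right_mono)
  qed
  moreover have "(\<lambda>k. exp K * norm (real (N k) *\<^sub>R (U k - 1) - real (N k) *\<^sub>R (V k - 1)))
      \<longlonglongrightarrow> exp K * norm (C - C)"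
    by (intro tendsto_intros U V)
  then have "(\<lambda>k. exp K * norm (real (N k) *\<^sub>R (U k - 1) - real (N k) *\<^sub>R (V k - 1))) \<longlonglongrightarrow> 0"
    by (simp only: diff_self norm_zero mult_zero_right)
  ultimately have "(\<lambda>k. U k ^ N k - V k ^ N k) \<longlonglongrightarrow> 0"
    by (rule Lim_null_comparison)
  moreover have "(\<lambda>k. V k ^ N k) \<longlonglongrightarrow> exp C"
    by (rule tendsto_eventually, rule eventually_mono[OF pos]) (simp add: V_def exp_scaleR_inverse_power)
  ultimately have "(\<lambda>k. (U k ^ N k - V k ^ N k) + V k ^ N k) \<longlonglongrightarrow> 0 + exp C"
    by (rule tendsto_add)
  then show ?thesis by simp
qed

lemma filterlim_power_2_at_top: "filterlim (\<lambda>k. 2 ^ k :: nat) at_top sequentially"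
  by (rule filterlim_at_top_mono[OF filterlim_ident]) (simp add: less_imp_le)

text \<open>With N = 2^k, N (exp (A/N) exp (B/N) - 1) splits into N (exp (A/N) - 1) exp (B/N) + N
  (exp (B/N) - 1), which tends to A + B. The exponents are powers of two because the trace
  inequalities below are proved by repeated squaring.\<close>

lemma Lie_product_formula:
  fixes A B :: "'a::{real_normed_algebra_1, banach}"
  shows "(\<lambda>k. (exp (A /\<^sub>R 2 ^ k) * exp (B /\<^sub>R 2 ^ k)) ^ 2 ^ k) \<longlonglongrightarrow> exp (A + B)"
proof -
  define N :: "nat \<Rightarrow> nat" where "N k = 2 ^ k" for k
  have N: "filterlim N at_top sequentially"
    unfolding N_def by (rule filterlim_power_2_at_top)
  have "(\<lambda>k. inverse (real (N k))) \<longlonglongrightarrow> 0"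
    by (intro tendsto_inverse_0_at_top filterlim_compose[OF filterlim_real_sequentially N])
  \<comment> \<open>The limit exp (B/N) -> 1 comes from writing it as 1/N times the scaled
    difference, plus 1.\<close>
  then have "(\<lambda>k. inverse (real (N k)) *\<^sub>R (real (N k) *\<^sub>R (exp (B /\<^sub>R real (N k)) - 1)) + 1)
      \<longlonglongrightarrow> 0 *\<^sub>R B + 1"
    by (intro tendsto_intros exp_scaled_diff_tendsto N)
  then have "(\<lambda>k. exp (B /\<^sub>R real (N k))) \<longlonglongrightarrow> 1"
    by (simp add: N_def)
  then have "(\<lambda>k. (real (N k) *\<^sub>R (exp (A /\<^sub>R real (N k)) - 1)) * exp (B /\<^sub>R real (N k)) +
      real (N k) *\<^sub>R (exp (B /\<^sub>R real (N k)) - 1)) \<longlonglongrightarrow> A * 1 + B"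
    by (intro tendsto_add tendsto_mult exp_scaled_diff_tendsto N)
  then have "(\<lambda>k. real (N k) *\<^sub>R (exp (A /\<^sub>R real (N k)) * exp (B /\<^sub>R real (N k)) - 1)) \<longlonglongrightarrow> A + B"
    by (simp add: algebra_simps)
  from power_tendsto_exp[OF this N] show ?thesis
    by (simp add: N_def)
qed

section \<open>Trace inequalities for powers of products\<close>

lemma tr_power_mult_commute: "tr ((A * B) ^ k) = tr ((B * A) ^ k)"
proof (cases k)
  case (Suc j)
  have "(A * B) ^ j * A = A * (B * A) ^ j" for j
    by (induction j) (simp_all add: mult.assoc)
  then have "(A * B) ^ k = A * ((B * A) ^ j * B)"
    unfolding Suc power_Suc2 by (metis mult.assoc)
  then have "tr ((A * B) ^ k) = tr ((B * A) ^ j * B * A)"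
    by (simp add: tr_mult_commute)
  also have "(B * A) ^ j * B * A = (B * A) ^ k"
    unfolding Suc power_Suc2 by (rule mult.assoc)
  finally show ?thesis .
qed simp

text \<open>Cauchy-Schwarz for the Frobenius inner product of \<open>tp A\<close> and
  \<open>B\<close>. The vectors of vectors \<open>a\<close> and \<open>b\<close> make it the
  library's inner product.\<close>

lemma tr_Cauchy_Schwarz: "(tr (A * B))\<^sup>2 \<le> tr (A * tp A) * tr (B * tp B)"
proof -
  define a where "a = (\<chi> i. app (tp A) (axis i 1))"
  define b where "b = (\<chi> i. app B (axis i 1))"
  have "tr (A * B) = a \<bullet> b" "tr (A * tp A) = a \<bullet> a" "tr (B * tp B) = b \<bullet> b"
    using tr_tp_mult[of "tp A" B] tr_tp_mult[of "tp A" "tp A"] tr_tp_mult[of B B]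
    by (simp_all add: a_def b_def inner_vec_def tr_mult_commute[of B])
  then show ?thesis
    by (simp add: Cauchy_Schwarz_ineq)
qed

text \<open>Induction by doubling, for all \<open>A\<close> and \<open>B\<close> at once: the power
  2^(k+1) of A B is the power 2^k of (A B)(A B), a product to which the induction hypothesis
  applies.\<close>

lemma tr_power_Cauchy_Schwarz:
  "(tr ((A * B) ^ 2 ^ k))\<^sup>2 \<le> tr ((A * tp A) ^ 2 ^ k) * tr ((B * tp B) ^ 2 ^ k)"
proof (induction k arbitrary: A B)
  case 0
  then show ?case by (simp add: tr_Cauchy_Schwarz)
next
  case (Suc k)
  define a where "a = tr ((A * B * tp (A * B)) ^ 2 ^ k)"
  have double: "Z ^ 2 ^ Suc k = (Z * Z) ^ 2 ^ k" for Z :: "'a sqmat"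
    by (simp add: power_mult power2_eq_square)
  have "a = tr ((A * (B * tp B * tp A)) ^ 2 ^ k)"
    by (simp add: a_def mult.assoc)
  also have "\<dots> = tr ((B * tp B * (tp A * A)) ^ 2 ^ k)"
    by (subst tr_power_mult_commute) (simp add: mult.assoc)
  finally have a: "a = tr ((B * tp B * (tp A * A)) ^ 2 ^ k)" .
  have "(tr ((A * B) ^ 2 ^ Suc k))\<^sup>2 \<le> a\<^sup>2"
    using Suc[of "A * B" "A * B"] by (simp only: double a_def power2_eq_square)
  \<comment> \<open>By cyclicity \<open>a\<close> is also the trace belonging to the symmetric pair
    B B^T, A^T A, so the induction hypothesis applies a second time.\<close>
  also have "\<dots> \<le> tr ((B * tp B) ^ 2 ^ Suc k) * tr ((tp A * A) ^ 2 ^ Suc k)"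
    using Suc[of "B * tp B" "tp A * A"] by (simp only: double a tp_simps)
  also have "tr ((tp A * A) ^ 2 ^ Suc k) = tr ((A * tp A) ^ 2 ^ Suc k)"
    by (rule tr_power_mult_commute)
  finally show ?case by (simp add: mult.commute)
qed

text \<open>For symmetric factors, Cauchy-Schwarz followed by cyclicity replaces (A B)^(2^(k+1)) by
  (A^2 B^2)^(2^k) under the trace; iteration separates the factors. Absolute values enter because
  squares of traces are compared.\<close>

lemma tr_power_mult_le:
  assumes "tp A = A" "tp B = B"
  shows "\<bar>tr ((A * B) ^ 2 ^ k)\<bar> \<le> \<bar>tr (A ^ 2 ^ k * B ^ 2 ^ k)\<bar>"
  using assms
proof (induction k arbitrary: A B)
  case (Suc k)
  have double: "Z ^ 2 ^ Suc k = (Z * Z) ^ 2 ^ k" for Z :: "'a sqmat"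
    by (simp add: power_mult power2_eq_square)
  have "tr ((A * B * tp (A * B)) ^ 2 ^ k) = tr ((A * (B * B * A)) ^ 2 ^ k)"
    using Suc.prems by (simp add: mult.assoc)
  also have "\<dots> = tr ((B * B * (A * A)) ^ 2 ^ k)"
    by (subst tr_power_mult_commute) (simp add: mult.assoc)
  also have "\<dots> = tr ((A * A * (B * B)) ^ 2 ^ k)"
    by (rule tr_power_mult_commute)
  finally have "(tr ((A * B) ^ 2 ^ Suc k))\<^sup>2 \<le> (tr ((A * A * (B * B)) ^ 2 ^ k))\<^sup>2"
    using tr_power_Cauchy_Schwarz[of "A * B" "A * B" k] by (simp only: double power2_eq_square)
  then have "\<bar>tr ((A * B) ^ 2 ^ Suc k)\<bar> \<le> \<bar>tr ((A * A * (B * B)) ^ 2 ^ k)\<bar>"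
    by (simp add: abs_le_square_iff)
  also have "\<dots> \<le> \<bar>tr ((A * A) ^ 2 ^ k * (B * B) ^ 2 ^ k)\<bar>"
    using Suc.prems by (intro Suc.IH) simp_all
  finally show ?case by (simp only: double)
qed simp

section \<open>Exponentials of symmetric matrices\<close>

lemma tp_exp: "tp (exp A) = exp (tp A)"
proof -
  have "tp (exp A) = (\<Sum>k. tp (A ^ k /\<^sub>R fact k))"
    unfolding exp_def by (rule bounded_linear.suminf[OF bounded_linear_tp summable_exp_generic])
  then show ?thesis
    by (simp add: exp_def tp_power)
qed

lemma exp_half_square:
  fixes A :: "'a::{real_normed_algebra_1, banach}"
  shows "exp A = exp (A /\<^sub>R 2) * exp (A /\<^sub>R 2)"
  using exp_scaleR_inverse_power[of 2 A] by (simp add: power2_eq_square)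

text \<open>The exponential is the square of the symmetric E = exp (A/2), and by cyclicity E E Y has
  the trace of E Y E. Bounds on the quadratic form of \<open>Y\<close> thus become bounds on the
  trace.\<close>

lemma tr_exp_mult_conv_sum:
  assumes "tp A = A"
  shows "tr (exp A * Y) = (\<Sum>i\<in>UNIV. app (exp (A /\<^sub>R 2)) (axis i 1) \<bullet> app Y (app (exp (A /\<^sub>R 2)) (axis i 1)))"
proof -
  have "tr (exp A * Y) = tr (tp (exp (A /\<^sub>R 2)) * (Y * exp (A /\<^sub>R 2)))"
    using assms by (subst exp_half_square, subst mult.assoc, subst tr_mult_commute) (simp add: tp_exp mult.assoc)
  then show ?thesis
    by (simp only: tr_tp_mult app_linear_simps)
qed

lemma tr_exp_mult_le:
  assumes "tp A = A" and "\<And>v. v \<bullet> app Y v \<le> r * (v \<bullet> v)"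
  shows "tr (exp A * Y) \<le> r * tr (exp A)"
  using tr_exp_mult_conv_sum[OF assms(1), of Y] tr_exp_mult_conv_sum[OF assms(1), of 1] assms(2)
  by (simp add: sum_distrib_left sum_mono)

lemma inner_app_exp_nonneg:
  assumes "tp A = A"
  shows "0 \<le> v \<bullet> app (exp A) v"
proof -
  have "v \<bullet> app (exp A) v = app (exp (A /\<^sub>R 2)) v \<bullet> app (exp (A /\<^sub>R 2)) v"
    using assms by (subst exp_half_square) (simp add: app_tp tp_exp)
  then show ?thesis by simp
qed

text \<open>The trace inequality is applied to exp (A / 2^k) and exp (B / 2^k), whose 2^k-th powers
  are exp A and exp B; the Lie product formula gives the limit of the left side.\<close>

theorem Golden_Thompson:
  assumes "tp A = A" "tp B = B"
  shows "tr (exp (A + B)) \<le> tr (exp A * exp B)"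
proof -
  have "(\<lambda>k. \<bar>tr ((exp (A /\<^sub>R 2 ^ k) * exp (B /\<^sub>R 2 ^ k)) ^ 2 ^ k)\<bar>) \<longlonglongrightarrow> \<bar>tr (exp (A + B))\<bar>"
    by (intro tendsto_rabs bounded_linear.tendsto[OF bounded_linear_tr] Lie_product_formula)
  moreover have "\<bar>tr ((exp (A /\<^sub>R 2 ^ k) * exp (B /\<^sub>R 2 ^ k)) ^ 2 ^ k)\<bar> \<le> \<bar>tr (exp A * exp B)\<bar>" for k
    using tr_power_mult_le[of "exp (A /\<^sub>R 2 ^ k)" "exp (B /\<^sub>R 2 ^ k)" k] assms
      exp_scaleR_inverse_power[of "2 ^ k" A] exp_scaleR_inverse_power[of "2 ^ k" B]
    by (simp add: tp_exp)
  ultimately have "\<bar>tr (exp (A + B))\<bar> \<le> \<bar>tr (exp A * exp B)\<bar>"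
    by (intro LIMSEQ_le_const2) auto
  moreover have "0 \<le> tr (exp A * exp B)"
    unfolding tr_exp_mult_conv_sum[OF assms(1)]
    by (intro sum_nonneg inner_app_exp_nonneg assms)
  ultimately show ?thesis by simp
qed

text \<open>This bounds the exponential of the largest eigenvalue by the trace, without
  diagonalisation. First exp (v . A v) \<le> v . exp(A) v, as in Jensen's inequality; then the trace
  dominates the right side.\<close>

lemma exp_le_tr_exp:
  assumes sym: "tp A = A" and v: "v \<bullet> v = 1" and x: "x \<le> v \<bullet> app A v"
  shows "exp x \<le> tr (exp A)"
proof -
  define N :: "nat \<Rightarrow> nat" where "N k = 2 ^ k" for k
  define y where "y k = v \<bullet> app (exp (A /\<^sub>R N k)) v" for k
  have N: "filterlim N at_top sequentially"
    unfolding N_def by (rule filterlim_power_2_at_top)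
  have lim: "(\<lambda>k. v \<bullet> app (real (N k) *\<^sub>R (exp (A /\<^sub>R N k) - 1)) v) \<longlonglongrightarrow> v \<bullet> app A v"
    by (intro tendsto_inner tendsto_const bounded_linear.tendsto[OF bounded_linear_app]
        exp_scaled_diff_tendsto N)
  have eq: "v \<bullet> app (real (N k) *\<^sub>R (exp (A /\<^sub>R N k) - 1)) v = real (N k) *\<^sub>R (y k - 1)" for k
    by (simp add: y_def v inner_diff_right linear_diff[OF bounded_linear.linear[OF bounded_linear_app]])
  \<comment> \<open>The power limit for reals: \<open>y k\<close> is 1 + (v . A v)/N up to
    o(1/N).\<close>
  have "(\<lambda>k. y k ^ N k) \<longlonglongrightarrow> exp (v \<bullet> app A v)"
    by (rule power_tendsto_exp[OF lim[unfolded eq] N])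
  moreover have "y k ^ N k \<le> v \<bullet> app (exp A) v" for k
  proof -
    \<comment> \<open>Repeated Cauchy-Schwarz: (v . B v)^2 \<le> |B v|^2 = v . B^2 v for unit
      \<open>v\<close> and symmetric \<open>B\<close>.\<close>
    have "(v \<bullet> app B v) ^ 2 ^ j \<le> v \<bullet> app (B ^ 2 ^ j) v" if "tp B = B" "0 \<le> v \<bullet> app B v" for B j
      using that
    proof (induction j arbitrary: B)
      case (Suc j)
      have "(v \<bullet> app B v)\<^sup>2 \<le> (v \<bullet> v) * (app B v \<bullet> app B v)"
        by (rule Cauchy_Schwarz_ineq)
      also have "\<dots> = v \<bullet> app (B * B) v"
        using Suc.prems v by (simp add: app_tp)
      finally have *: "(v \<bullet> app B v)\<^sup>2 \<le> v \<bullet> app (B * B) v" .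
      have "(v \<bullet> app B v) ^ 2 ^ Suc j = ((v \<bullet> app B v)\<^sup>2) ^ 2 ^ j"
        by (simp add: power_mult)
      also have "\<dots> \<le> (v \<bullet> app (B * B) v) ^ 2 ^ j"
        by (intro power_mono *) simp
      also have "\<dots> \<le> v \<bullet> app ((B * B) ^ 2 ^ j) v"
        using Suc.prems by (intro Suc.IH order_trans[OF zero_le_power2 *]) simp
      also have "(B * B) ^ 2 ^ j = B ^ 2 ^ Suc j"
        by (simp add: power_mult power2_eq_square)
      finally show ?case .
    qed simp
    from this[of "exp (A /\<^sub>R N k)" k] show ?thesis
      using sym exp_scaleR_inverse_power[of "N k" A] inner_app_exp_nonneg[of "A /\<^sub>R N k" v]
      by (simp add: y_def N_def tp_exp)
  qed
  ultimately have *: "exp (v \<bullet> app A v) \<le> v \<bullet> app (exp A) v"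
    by (intro LIMSEQ_le_const2) auto
  \<comment> \<open>Now v . exp(A) v = |E v|^2 is at most the squared Frobenius norm of
    \<open>E\<close>, which is the trace of E E.\<close>
  define E where "E = exp (A /\<^sub>R 2)"
  have E: "tp E = E" "exp A = E * E"
    using sym by (simp add: E_def tp_exp) (simp only: E_def exp_half_square[of A])
  have row: "app E v $ i = app E (axis i 1) \<bullet> v" for i
    using E by (simp add: app_tp inner_axis')
  have "v \<bullet> app (exp A) v = app E v \<bullet> app E v"
    using E by (simp add: app_tp)
  also have "\<dots> = (\<Sum>i\<in>UNIV. (app E (axis i 1) \<bullet> v)\<^sup>2)"
    by (simp add: inner_vec_def power2_eq_square row)
  also have "\<dots> \<le> (\<Sum>i\<in>UNIV. app E (axis i 1) \<bullet> app E (axis i 1))"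
    by (intro sum_mono order_trans[OF Cauchy_Schwarz_ineq]) (simp add: v)
  also have "\<dots> = tr (exp A)"
    using tr_exp_mult_conv_sum[OF sym, of 1] by (simp add: E_def)
  finally show ?thesis
    using * x by (meson exp_le_cancel_iff order_trans)
qed

text \<open>All powers of \<open>P\<close> from the first on equal \<open>P\<close>; only the
  constant term of the series needs the correction 1 - P.\<close>

lemma exp_scaleR_idempotent:
  fixes P :: "'a::{real_normed_algebra_1, banach}"
  assumes "P * P = P"
  shows "exp (b *\<^sub>R P) = 1 + (exp b - 1) *\<^sub>R P"
proof -
  have P: "P ^ Suc k = P" for k
    by (induction k) (simp_all add: assms)
  have "(\<lambda>k. (b ^ k /\<^sub>R fact k) *\<^sub>R P + (if k = 0 then 1 - P else 0)) sums (exp b *\<^sub>R P + (1 - P))"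
    by (intro sums_add bounded_linear.sums[OF bounded_linear_scaleR_left] exp_converges)
      (use sums_single[of 0 "\<lambda>_. 1 - P"] in simp)
  also have "(\<lambda>k. (b ^ k /\<^sub>R fact k) *\<^sub>R P + (if k = 0 then 1 - P else 0)) = (\<lambda>k. (b *\<^sub>R P) ^ k /\<^sub>R fact k)"
  proof
    fix k show "(b ^ k /\<^sub>R fact k) *\<^sub>R P + (if k = 0 then 1 - P else 0) = (b *\<^sub>R P) ^ k /\<^sub>R fact k"
      by (cases k) (simp_all add: scaleR_power P divide_inverse mult.commute del: power_Suc)
  qed
  finally have "exp b *\<^sub>R P + (1 - P) = exp (b *\<^sub>R P)"
    using sums_unique2 exp_converges by blast
  then show ?thesis by (simp add: algebra_simps)
qed

subsection \<open>Greedy bound for weighted leverage scores\<close>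

lemma coherence_ge: "leverage Q j \<le> coherence Q"
  by (simp add: coherence_def)

text \<open>
  Duality for the linear program that maximises \<open>\<Sum>\<^sub>j \<ell>\<^sub>j w\<^sub>j\<close>: the multiplier of the constraint
  \<open>\<Sum>\<^sub>j w\<^sub>j = 1\<close> is \<open>\<ell>\<^sub>[\<^sub>t\<^sub>+\<^sub>1\<^sub>]\<close>.
\<close>
lemma weighted_leverage_le_lev_tau:
  fixes Q :: "real^'n::finite^'m::finite" and w :: "'m \<Rightarrow> real"
  assumes w: "\<And>j. 0 \<le> w j" "\<And>j. w j \<le> coherence Q" "(\<Sum>j\<in>UNIV. w j) = 1"
  shows "(\<Sum>j\<in>UNIV. leverage Q j * w j) \<le> lev_tau Q"
proof -
  define t where "t = lev_t Q"
  define xs where "xs = rev (sorted_list_of_multiset (image_mset (leverage Q) (mset_set UNIV)))"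
  \<comment> \<open>As \<open>xs\<close> is indexed from 0, this is \<open>xs ! t\<close> if t < m,
    and the default 0 if t = m.\<close>
  define l where "l = leverage_sorted Q (t + 1)"
  \<comment> \<open>At the leverage scores, \<open>g\<close> gives the multipliers of the
    constraints that bound each weight by \<mu>.\<close>
  define g where "g x = max (x - l) 0" for x
  have mset: "mset xs = image_mset (leverage Q) (mset_set UNIV)"
    by (simp add: xs_def)
  have len: "length xs = CARD('m)"
    by (metis mset size_image_mset size_mset size_mset_set)
  have mono: "xs ! i \<ge> xs ! j" if "i \<le> j" "j < length xs" for i j
    using that by (intro sorted_rev_nth_mono) (simp_all add: xs_def)
  \<comment> \<open>Summing the bounds on the weights gives 1 \<le> m \<mu>; hence \<mu> > 0 and t
    \<le> m.\<close>
  have "1 \<le> real CARD('m) * coherence Q"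
    using sum_mono[of UNIV w "\<lambda>_. coherence Q"] w by simp
  moreover have "0 \<le> coherence Q"
    by (meson w order_trans)
  ultimately have "0 < coherence Q"
    by (cases "coherence Q = 0") simp_all
  with \<open>1 \<le> real CARD('m) * coherence Q\<close> have "1 / coherence Q \<le> real CARD('m)"
    by (simp add: divide_le_eq)
  then have t_le: "t \<le> CARD('m)"
    unfolding t_def lev_t_def by linarith
  have nth: "leverage_sorted Q (Suc i) = xs ! i" if "i < CARD('m)" for i
    using that by (simp add: leverage_sorted_def xs_def)
  have nonneg: "0 \<le> xs ! i" if "i < CARD('m)" for i
  proof -
    have "xs ! i \<in># mset xs"
      using that len by simp
    then show ?thesis unfolding mset by (auto simp: leverage_def)
  qed
  \<comment> \<open>For t = m the claim is nonnegativity of the scores, by the default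
    value.\<close>
  have l_ge: "l \<le> xs ! i" if "i < t" for i
    using that t_le mono[of i t] nth[of t] nonneg[of i] len
    by (cases "t < CARD('m)") (auto simp: l_def leverage_sorted_def xs_def)
  have l_le: "xs ! i \<le> l" if "t \<le> i" "i < CARD('m)" for i
    using that mono[of t i] nth[of t] len by (simp add: l_def)
  have "(\<Sum>j\<in>UNIV. leverage Q j * w j) = l + (\<Sum>j\<in>UNIV. (leverage Q j - l) * w j)"
    using w(3) by (simp add: algebra_simps sum_subtractf flip: sum_distrib_left)
  also have "(\<Sum>j\<in>UNIV. (leverage Q j - l) * w j) \<le> (\<Sum>j\<in>UNIV. coherence Q * g (leverage Q j))"
  proof (rule sum_mono)
    fix j
    have "(leverage Q j - l) * w j \<le> g (leverage Q j) * w j"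
      using w(1) by (intro mult_right_mono) (simp_all add: g_def)
    also have "\<dots> \<le> g (leverage Q j) * coherence Q"
      using w(2) by (intro mult_left_mono) (simp_all add: g_def)
    finally show "(leverage Q j - l) * w j \<le> coherence Q * g (leverage Q j)"
      by (simp add: mult.commute)
  qed
  also have "\<dots> = coherence Q * sum_mset (image_mset g (mset xs))"
    by (simp add: mset sum_mset_distrib_left sum_unfold_sum_mset image_mset.compositionality o_def)
  also have "sum_mset (image_mset g (mset xs)) = sum_list (map g xs)"
    by (metis mset_map sum_mset_sum_list)
  also have "\<dots> = (\<Sum>i<CARD('m). g (xs ! i))"
    by (simp add: sum_list_sum_nth len atLeast0LessThan)
  also have "\<dots> = (\<Sum>i<t. g (xs ! i)) + (\<Sum>i\<in>{t..<CARD('m)}. g (xs ! i))"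
    using t_le by (metis atLeast0LessThan sum.atLeastLessThan_concat le0)
  also have "(\<Sum>i\<in>{t..<CARD('m)}. g (xs ! i)) = 0"
    using l_le by (intro sum.neutral) (simp add: g_def)
  also have "(\<Sum>i<t. g (xs ! i)) = (\<Sum>i<t. leverage_sorted Q (Suc i) - l)"
    using l_ge nth t_le by (intro sum.cong) (auto simp: g_def)
  also have "\<dots> = (\<Sum>j = 1..t. leverage_sorted Q j) - real t * l"
    by (simp add: sum_subtractf sum.atLeast1_atMost_eq)
  also have "l + coherence Q * (\<dots> + 0) = lev_tau Q"
    by (simp add: lev_tau_def t_def l_def algebra_simps)
  finally show ?thesis by simp
qed

subsection \<open>Condition number from bounds on a quadratic form\<close>

text \<open>The bounds place the singular values of \<open>A\<close> between sqrt a and sqrt b. The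
  lower one makes A^T A invertible, so that the Moore-Penrose inverse is (A^T A)^(-1) A^T.\<close>

lemma rank_cond2_bound:
  fixes A :: "real^'n::finite^'m::finite"
  assumes lower: "\<And>v. a * (norm v)\<^sup>2 \<le> (norm (A *v v))\<^sup>2"
    and upper: "\<And>v. (norm (A *v v))\<^sup>2 \<le> b * (norm v)\<^sup>2"
    and "0 < a"
  shows "rank A = CARD('n) \<and> cond2 A \<le> sqrt (b / a)"
proof
  have inj: "v = 0" if "A *v v = 0" for v
    using lower[of v] that \<open>0 < a\<close> by (simp add: mult_le_0_iff not_le)
  then have "inj ((*v) A)"
    by (simp add: linear_injective_0[OF matrix_vector_mul_linear])
  then show "rank A = CARD('n)"
    by (simp add: full_rank_injective)
  define G where "G = transpose A ** A"
  have "norm (A *v v) ^ 2 = v \<bullet> (G *v v)" for v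
    unfolding G_def power2_norm_eq_inner
    by (metis dot_lmul_matrix inner_commute matrix_vector_mul_assoc transpose_transpose vector_transpose_matrix)
  then have "inj ((*v) G)"
    unfolding linear_injective_0[OF matrix_vector_mul_linear]
    by (metis inj inner_zero_right norm_eq_zero zero_eq_power2)
  then obtain Gi where Gi: "Gi ** G = mat 1" "G ** Gi = mat 1"
    by (metis matrix_left_invertible_injective matrix_left_right_inverse)
  have sym: "transpose G = G"
    by (simp add: G_def matrix_transpose_mul)
  have Gi_sym: "transpose Gi = Gi"
    by (metis Gi sym matrix_mul_assoc matrix_mul_lid matrix_mul_rid matrix_transpose_mul transpose_mat)
  define X where "X = Gi ** transpose A"
  have XA: "X ** A = mat 1"
    by (metis Gi(1) G_def X_def matrix_mul_assoc)
  have AX_sym: "transpose (A ** X) = A ** X"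
    by (simp add: X_def matrix_transpose_mul Gi_sym matrix_mul_assoc)
  have "is_moore_penrose A X"
    using XA AX_sym by (simp add: is_moore_penrose_def flip: matrix_mul_assoc)
  then have X: "moore_penrose A = X"
    by (rule moore_penrose_eqI)
  have "0 \<le> b"
    using order_trans[OF lower upper, of "axis undefined 1"] \<open>0 < a\<close> by simp
  have "matrix_norm2 A \<le> sqrt b"
    unfolding matrix_norm2_def
  proof (rule onorm_le)
    show "norm (A *v v) \<le> sqrt b * norm v" for v
      using real_sqrt_le_mono[OF upper[of v]] by (simp add: real_sqrt_mult)
  qed
  moreover have "matrix_norm2 X \<le> 1 / sqrt a"
    unfolding matrix_norm2_def
  proof (rule onorm_le)
    fix y
    \<comment> \<open>This is the orthogonal projection of \<open>y\<close> onto the range of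
      \<open>A\<close>, so |z| \<le> |y|; the lower bound at X y then controls |X y|.\<close>
    define z where "z = A *v (X *v y)"
    have "z \<bullet> z = y \<bullet> ((A ** X) *v z)"
      unfolding z_def by (metis AX_sym dot_lmul_matrix inner_commute matrix_vector_mul_assoc vector_transpose_matrix)
    also have "(A ** X) *v z = z"
      unfolding z_def by (metis XA matrix_mul_assoc matrix_mul_rid matrix_vector_mul_assoc)
    finally have "norm z * norm z \<le> norm y * norm z"
      using norm_cauchy_schwarz[of y z] by (simp add: dot_square_norm power2_eq_square)
    then have "norm z \<le> norm y"
      by (cases "z = 0") auto
    moreover have "sqrt a * norm (X *v y) \<le> norm z"
      using real_sqrt_le_mono[OF lower[of "X *v y"]] by (simp add: real_sqrt_mult z_def)
    ultimately show "norm (X *v y) \<le> 1 / sqrt a * norm y"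
      using \<open>0 < a\<close> by (simp add: field_simps)
  qed
  ultimately have "cond2 A \<le> sqrt b * (1 / sqrt a)"
    unfolding cond2_def X using \<open>0 \<le> b\<close>
    by (intro mult_mono) (simp_all add: matrix_norm2_def onorm_pos_le matrix_vector_mul_bounded_linear)
  then show "cond2 A \<le> sqrt (b / a)"
    by (simp add: real_sqrt_divide)
qed

subsection \<open>Uniform sampling as counting\<close>

text \<open>Independence and uniformity make the sample uniform on a finite function space.
  Probabilities become counts, and the remaining estimates are about finite sums.\<close>

lemma uniform_sampling_prob:
  fixes k :: "'c::finite \<Rightarrow> 'w \<Rightarrow> 'm::finite"
  assumes "uniform_sampling M k"
  shows "\<P>(\<omega> in M. P (\<lambda>i. k i \<omega>)) = real (card {f. P f}) / real CARD('m) ^ CARD('c)"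
proof -
  interpret prob_space M
    using assms by (simp add: uniform_sampling_def)
  have indep: "indep_vars (\<lambda>_. count_space UNIV) k UNIV"
    and distr: "\<And>i. distr M (count_space UNIV) (k i) = uniform_count_measure UNIV"
    using assms by (simp_all add: uniform_sampling_def)
  have meas: "k i \<in> measurable M (count_space UNIV)" for i
    using indep by (auto simp: indep_vars_def)
  \<comment> \<open>The event that the whole sample equals \<open>f\<close>; these events are
    disjoint and each has probability m^(-c).\<close>
  define E where "E f = (\<Inter>i\<in>UNIV. k i -` {f i} \<inter> space M)" for f
  have E_sets: "E f \<in> events" for f
    unfolding E_def by (intro sets.finite_INT measurable_sets[OF meas]) auto
  have "prob (k i -` {x} \<inter> space M) = 1 / real CARD('m)" for i x
    using measure_distr[OF meas, of "{x}" i] distr[of i]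
    by (simp add: measure_uniform_count_measure)
  then have "prob (E f) = (1 / real CARD('m)) ^ CARD('c)" for f
    unfolding E_def by (subst indep_varsD_finite[OF indep]) simp_all
  moreover have "prob (\<Union>f\<in>{f. P f}. E f) = (\<Sum>f\<in>{f. P f}. prob (E f))"
  proof (rule finite_measure_finite_Union)
    show "disjoint_family_on E {f. P f}"
      by (auto simp: disjoint_family_on_def E_def)
  qed (use E_sets in auto)
  moreover have "(\<Union>f\<in>{f. P f}. E f) = {\<omega> \<in> space M. P (\<lambda>i. k i \<omega>)}"
    by (auto simp: E_def simp flip: fun_eq_iff)
  ultimately show ?thesis
    by (simp add: power_one_over)
qed

subsection \<open>A Bernstein-type bound for the exponential\<close>

text \<open>Since (k + 2)! \<ge> 2 * 3^k, the exponential series after its linear term is dominated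
  by a geometric series of ratio y/3.\<close>

lemma exp_le_Bernstein:
  fixes x :: real
  assumes "\<bar>x\<bar> \<le> y" "y < 3"
  shows "exp x \<le> 1 + x + x\<^sup>2 / (2 * (1 - y / 3))"
proof -
  have "exp x = 1 + x + (\<Sum>k. inverse (fact (k + 2)) * x ^ (k + 2))"
    using exp_first_two_terms[of x] by simp
  also have "(\<Sum>k. inverse (fact (k + 2)) * x ^ (k + 2)) \<le> (\<Sum>k. x\<^sup>2 / 2 * (y / 3) ^ k)"
  proof (rule suminf_le)
    show "summable (\<lambda>k. inverse (fact (k + 2)) * x ^ (k + 2))"
      using summable_iff_shift[of "\<lambda>k. inverse (fact k) * x ^ k" 2] summable_exp[of x] by simp
    show "summable (\<lambda>k. x\<^sup>2 / 2 * (y / 3) ^ k)"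
      using assms by (intro summable_mult summable_geometric) auto
    fix k
    have fact: "2 * 3 ^ k \<le> (fact (k + 2) :: real)"
    proof (induction k)
      case (Suc k)
      have "3 * (2 * 3 ^ k) \<le> (real k + 3) * fact (k + 2)"
        using Suc by (intro mult_mono) auto
      then show ?case by (simp add: algebra_simps)
    qed simp
    have "x ^ k * x\<^sup>2 \<le> \<bar>x ^ k\<bar> * x\<^sup>2"
      by (intro mult_right_mono) simp_all
    then have "x ^ (k + 2) \<le> x\<^sup>2 * \<bar>x\<bar> ^ k"
      by (simp only: power_add power_abs mult.commute)
    then have "inverse (fact (k + 2)) * x ^ (k + 2) \<le> inverse (fact (k + 2)) * (x\<^sup>2 * \<bar>x\<bar> ^ k)"
      by (intro mult_left_mono) simp_all
    also have "\<dots> \<le> inverse (2 * 3 ^ k) * (x\<^sup>2 * y ^ k)"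
      using assms(1) fact
      by (intro mult_mono[OF le_imp_inverse_le mult_left_mono[OF power_mono]]) auto
    also have "\<dots> = x\<^sup>2 / 2 * (y / 3) ^ k"
      by (simp add: power_divide field_simps)
    finally show "inverse (fact (k + 2)) * x ^ (k + 2) \<le> x\<^sup>2 / 2 * (y / 3) ^ k" .
  qed
  also have "(\<Sum>k. x\<^sup>2 / 2 * (y / 3) ^ k) = x\<^sup>2 / (2 * (1 - y / 3))"
    using assms by (subst suminf_mult, intro summable_geometric) (auto simp: suminf_geometric)
  finally show ?thesis by simp
qed

subsection \<open>Exponential moments of sampled matrix sums\<close>

lift_definition outer :: "real^'n::finite \<Rightarrow> 'n sqmat" is "\<lambda>q. \<chi> i j. q $ i * q $ j" .

lemma app_outer: "app (outer q) v = (q \<bullet> v) *\<^sub>R q"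
  by transfer (simp add: matrix_vector_mult_def inner_vec_def vec_eq_iff sum_distrib_left
      sum_distrib_right mult_ac)

lemma tp_outer [simp]: "tp (outer q) = outer q"
  by transfer (simp add: transpose_def mult.commute)

text \<open>For nonzero \<open>q\<close>, q q^T / (q . q) is idempotent, which makes the exponential
  explicit. For q = 0 the quotient is 0 by convention and both sides are v . v.\<close>

lemma inner_app_exp_outer:
  "v \<bullet> app (exp (a *\<^sub>R outer q)) v = v \<bullet> v + (exp (a * (q \<bullet> q)) - 1) / (q \<bullet> q) * (q \<bullet> v)\<^sup>2"
proof (cases "q = 0")
  case True
  then have "outer q = 0"
    by (intro sqmat_eqI) (simp add: app_outer)
  then show ?thesis using True by simp
next
  case False
  define P where "P = outer q /\<^sub>R (q \<bullet> q)"
  have "P * P = P"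
    using False by (intro sqmat_eqI) (simp add: P_def app_outer)
  moreover have "a *\<^sub>R outer q = (a * (q \<bullet> q)) *\<^sub>R P"
    using False by (simp add: P_def)
  ultimately have "exp (a *\<^sub>R outer q) = 1 + (exp (a * (q \<bullet> q)) - 1) *\<^sub>R P"
    by (simp add: exp_scaleR_idempotent)
  then show ?thesis
    by (simp add: P_def app_outer inner_add_right inner_commute[of v q] power2_eq_square field_simps)
qed

lemma tp_sum: "tp (\<Sum>i\<in>I. A i) = (\<Sum>i\<in>I. tp (A i))"
  by (rule linear_sum[OF bounded_linear.linear[OF bounded_linear_tp]])

lemma app_sum: "app (\<Sum>i\<in>I. A i) v = (\<Sum>i\<in>I. app (A i) v)"
  by (rule linear_sum[OF bounded_linear.linear[OF bounded_linear_app]])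

lemma tr_sum: "tr (\<Sum>i\<in>I. A i) = (\<Sum>i\<in>I. tr (A i))"
  by (rule linear_sum[OF bounded_linear.linear[OF bounded_linear_tr]])

text \<open>An unnormalised expectation over all samples. Golden-Thompson splits off the factor of
  one index, and summing it over its values costs a factor \<open>r\<close>. Extensional functions
  permit induction on \<open>I\<close>.\<close>

lemma sum_tr_exp_le:
  fixes Y :: "'m::finite \<Rightarrow> 'n::finite sqmat"
  assumes "finite I" and sym: "\<And>j. tp (Y j) = Y j" and "0 \<le> r"
    and r: "\<And>v. v \<bullet> app (\<Sum>j\<in>UNIV. exp (Y j)) v \<le> r * (v \<bullet> v)"
  shows "(\<Sum>f\<in>I \<rightarrow>\<^sub>E UNIV. tr (exp (\<Sum>i\<in>I. Y (f i)))) \<le> r ^ card I * real CARD('n)"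
  using \<open>finite I\<close>
proof induction
  case empty
  then show ?case by (simp add: tr_1)
next
  case (insert a I)
  define S where "S f = (\<Sum>i\<in>I. Y (f i))" for f
  have S: "tp (S f) = S f" for f
    by (simp add: S_def tp_sum sym)
  have upd: "(\<Sum>i\<in>insert a I. Y ((f(a := j)) i)) = S f + Y j" for f j
  proof -
    have "(\<Sum>i\<in>I. Y ((f(a := j)) i)) = S f"
      unfolding S_def using insert.hyps by (intro sum.cong) auto
    then show ?thesis using insert.hyps by (simp add: add.commute)
  qed
  \<comment> \<open>A function on \<open>insert a I\<close> is its value at \<open>a\<close>
    together with its restriction to \<open>I\<close>.\<close>
  have "(\<Sum>f\<in>insert a I \<rightarrow>\<^sub>E UNIV. tr (exp (\<Sum>i\<in>insert a I. Y (f i)))) =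
      (\<Sum>(j, f)\<in>UNIV \<times> (I \<rightarrow>\<^sub>E UNIV). tr (exp (\<Sum>i\<in>insert a I. Y ((f(a := j)) i))))"
    unfolding PiE_insert_eq using insert.hyps
    by (subst sum.reindex[OF inj_combinator]) (simp_all add: case_prod_unfold)
  also have "\<dots> = (\<Sum>f\<in>I \<rightarrow>\<^sub>E UNIV. \<Sum>j\<in>UNIV. tr (exp (S f + Y j)))"
    unfolding upd by (subst sum.cartesian_product[symmetric]) (rule sum.swap)
  also have "\<dots> \<le> (\<Sum>f\<in>I \<rightarrow>\<^sub>E UNIV. \<Sum>j\<in>UNIV. tr (exp (S f) * exp (Y j)))"
    by (intro sum_mono Golden_Thompson S sym)
  also have "\<dots> = (\<Sum>f\<in>I \<rightarrow>\<^sub>E UNIV. tr (exp (S f) * (\<Sum>j\<in>UNIV. exp (Y j))))"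
    by (simp add: sum_distrib_left tr_sum)
  also have "\<dots> \<le> (\<Sum>f\<in>I \<rightarrow>\<^sub>E UNIV. r * tr (exp (S f)))"
    by (intro sum_mono tr_exp_mult_le S r)
  also have "\<dots> \<le> r * (r ^ card I * real CARD('n))"
    unfolding S_def sum_distrib_left[symmetric] using insert.IH \<open>0 \<le> r\<close> by (rule mult_left_mono)
  finally show ?case using insert.hyps by simp
qed

text \<open>Markov's inequality for the trace of the exponential, in counting form: each counted
  \<open>f\<close> contributes at least \<open>exp x\<close>.\<close>

lemma card_large_quadratic_form_le:
  fixes Y :: "'m::finite \<Rightarrow> 'n::finite sqmat"
  assumes sym: "\<And>j. tp (Y j) = Y j" and "0 \<le> r"
    and r: "\<And>v. v \<bullet> app (\<Sum>j\<in>UNIV. exp (Y j)) v \<le> r * (v \<bullet> v)"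
  shows "real (card {f :: 'c::finite \<Rightarrow> 'm. \<exists>v. v \<bullet> v = 1 \<and> x \<le> (\<Sum>i\<in>UNIV. v \<bullet> app (Y (f i)) v)}) * exp x
    \<le> r ^ CARD('c) * real CARD('n)"
proof -
  define B where "B = {f :: 'c \<Rightarrow> 'm. \<exists>v. v \<bullet> v = 1 \<and> x \<le> (\<Sum>i\<in>UNIV. v \<bullet> app (Y (f i)) v)}"
  have symS: "tp (\<Sum>i\<in>UNIV. Y (f i)) = (\<Sum>i\<in>UNIV. Y (f i))" for f :: "'c \<Rightarrow> 'm"
    by (simp add: tp_sum sym)
  have "real (card B) * exp x = (\<Sum>f\<in>B. exp x)"
    by simp
  also have "\<dots> \<le> (\<Sum>f\<in>B. tr (exp (\<Sum>i\<in>UNIV. Y (f i))))"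
  proof (rule sum_mono)
    fix f assume "f \<in> B"
    then obtain v where "v \<bullet> v = 1" "x \<le> v \<bullet> app (\<Sum>i\<in>UNIV. Y (f i)) v"
      by (auto simp: B_def app_sum inner_sum_right)
    then show "exp x \<le> tr (exp (\<Sum>i\<in>UNIV. Y (f i)))"
      by (intro exp_le_tr_exp symS)
  qed
  also have "\<dots> \<le> (\<Sum>f :: 'c \<Rightarrow> 'm\<in>UNIV. tr (exp (\<Sum>i\<in>UNIV. Y (f i))))"
  proof (rule sum_mono2)
    fix f :: "'c \<Rightarrow> 'm"
    show "0 \<le> tr (exp (\<Sum>i\<in>UNIV. Y (f i)))"
      using tr_exp_mult_conv_sum[OF symS, of f 1] by (simp add: sum_nonneg)
  qed simp_all
  also have "\<dots> \<le> r ^ CARD('c) * real CARD('n)"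
    using sum_tr_exp_le[of "UNIV :: 'c set" Y r] assms by simp
  finally show ?thesis by (simp add: B_def)
qed

section \<open>Sampled quadratic form, leverage scores and deviation bound\<close>

lemma norm_sampling_matrix_mult:
  fixes Q :: "real^'n::finite^'m::finite" and f :: "'c::finite \<Rightarrow> 'm"
  shows "(norm ((sampling_matrix f ** Q) *v v))\<^sup>2 =
    (\<Sum>i\<in>UNIV. real CARD('m) / real CARD('c) * (row (f i) Q \<bullet> v)\<^sup>2)"
proof -
  have comp: "((sampling_matrix f ** Q) *v v) $ i = sqrt (real CARD('m) / real CARD('c)) * (row (f i) Q \<bullet> v)" for i
  proof -
    have "(\<Sum>j\<in>UNIV. axis (f i) 1 $ j * (Q *v v) $ j) = (Q *v v) $ f i"
      using inner_axis'[of "f i" "1::real" "Q *v v", unfolded inner_vec_def]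
      by (simp only: inner_real_def mult_1)
    then show ?thesis
      by (simp add: sampling_matrix_def matrix_vector_mul_component row_def
          flip: matrix_vector_mul_assoc scaleR_matrix_vector_assoc)
        (simp add: matrix_vector_mult_def inner_vec_def)
  qed
  have "(norm ((sampling_matrix f ** Q) *v v))\<^sup>2 = (\<Sum>i\<in>UNIV. (((sampling_matrix f ** Q) *v v) $ i)\<^sup>2)"
    unfolding power2_norm_eq_inner by (simp add: inner_vec_def power2_eq_square)
  then show ?thesis
    unfolding comp power_mult_distrib by simp
qed

lemma sum_row_inner_power2:
  fixes Q :: "real^'n::finite^'m::finite"
  assumes "transpose Q ** Q = mat 1"
  shows "(\<Sum>j\<in>UNIV. (row j Q \<bullet> v)\<^sup>2) = v \<bullet> v"
proof -
  have "(Q *v v) \<bullet> (Q *v v) = v \<bullet> v"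
    unfolding dot_lmul_matrix[symmetric] transpose_matrix_vector[symmetric]
    by (simp only: matrix_vector_mul_assoc assms matrix_vector_mul_lid)
  moreover have "(Q *v v) \<bullet> (Q *v v) = (\<Sum>j\<in>UNIV. (row j Q \<bullet> v)\<^sup>2)"
    by (simp add: inner_vec_def[of "Q *v v"] power2_eq_square matrix_vector_mul_component row_def)
  ultimately show ?thesis by simp
qed

lemma leverage_row: "leverage Q j = row j Q \<bullet> row j Q"
proof -
  have "axis j 1 v* Q = row j Q"
    by (simp add: vector_matrix_mult_def row_def vec_eq_iff axis_def if_distrib if_distribR cong: if_cong)
  then show ?thesis by (simp add: leverage_def power2_norm_eq_inner)
qed

lemma row_inner_power2_le: "(row j Q \<bullet> v)\<^sup>2 \<le> leverage Q j * (v \<bullet> v)"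
  unfolding leverage_row by (rule Cauchy_Schwarz_ineq)

text \<open>Divided by v . v, the squared row products are admissible weights: each is at most \<mu>
  by Cauchy-Schwarz, and they sum to 1 because \<open>Q\<close> is an isometry.\<close>

lemma sum_leverage_row_inner_le:
  fixes Q :: "real^'n::finite^'m::finite"
  assumes Q: "transpose Q ** Q = mat 1"
  shows "(\<Sum>j\<in>UNIV. leverage Q j * (row j Q \<bullet> v)\<^sup>2) \<le> lev_tau Q * (v \<bullet> v)"
proof (cases "v = 0")
  case False
  define w where "w j = (row j Q \<bullet> v)\<^sup>2 / (v \<bullet> v)" for j
  have pos: "0 < v \<bullet> v" using False by simp
  have "(\<Sum>j\<in>UNIV. leverage Q j * w j) \<le> lev_tau Q"
  proof (rule weighted_leverage_le_lev_tau)
    show "w j \<le> coherence Q" for j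
      using order_trans[OF row_inner_power2_le[of j Q v] mult_right_mono[OF coherence_ge[of Q j]]] pos
      by (simp add: w_def divide_le_eq)
    show "(\<Sum>j\<in>UNIV. w j) = 1"
      using sum_row_inner_power2[OF Q, of v] pos by (simp add: w_def flip: sum_divide_distrib)
  qed (simp add: w_def)
  then show ?thesis
    using pos by (simp add: w_def divide_le_eq flip: sum_divide_distrib)
qed simp

text \<open>A unit vector has a nonzero product with some row, whose leverage score is then
  positive. This justifies the later divisions by the variance and by \<open>D\<close>.\<close>

lemma coherence_pos_lev_tau_pos:
  fixes Q :: "real^'n::finite^'m::finite"
  assumes Q: "transpose Q ** Q = mat 1"
  shows "0 < coherence Q" and "0 < lev_tau Q"
proof -
  define v :: "real^'n" where "v = axis undefined 1"
  have v: "v \<bullet> v = 1" by (simp add: v_def inner_axis_axis)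
  then obtain j where j: "(row j Q \<bullet> v)\<^sup>2 \<noteq> 0"
    using sum_row_inner_power2[OF Q, of v] sum.not_neutral_contains_not_neutral by force
  then have "0 < (row j Q \<bullet> v)\<^sup>2"
    by (simp add: less_le)
  then have lev: "0 < leverage Q j"
    using row_inner_power2_le[of j Q v] unfolding v mult_1_right by (rule less_le_trans)
  then show "0 < coherence Q"
    using coherence_ge[of Q j] by simp
  have "0 < leverage Q j * (row j Q \<bullet> v)\<^sup>2"
    using lev \<open>0 < (row j Q \<bullet> v)\<^sup>2\<close> by simp
  also have "\<dots> \<le> (\<Sum>j\<in>UNIV. leverage Q j * (row j Q \<bullet> v)\<^sup>2)"
    by (rule member_le_sum) (simp_all add: leverage_def)
  also have "\<dots> \<le> lev_tau Q"
    using sum_leverage_row_inner_le[OF Q, of v] v by simp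
  finally show "0 < lev_tau Q" .
qed

text \<open>
  The matrices \<open>(m/c) q q\<^sup>T\<close> are not centred: their mean contributes \<open>s \<theta>\<close> to the exponent of the moment
  bound, which cancels against the same term of the threshold \<open>s \<theta> (1 + s \<epsilon>)\<close>.
\<close>
lemma card_deviation_le:
  fixes Q :: "real^'n::finite^'m::finite" and s \<epsilon> :: real
  defines "D \<equiv> real CARD('m) / real CARD('c) * (lev_tau Q + coherence Q * \<epsilon> / 3)"
  assumes Q: "transpose Q ** Q = mat 1" and s: "\<bar>s\<bar> = 1" and "0 < \<epsilon>"
  shows "real (card {f :: 'c::finite \<Rightarrow> 'm. \<exists>v. v \<bullet> v = 1 \<and>
        s * (1 + s * \<epsilon>) \<le> s * (norm ((sampling_matrix f ** Q) *v v))\<^sup>2})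
      \<le> real CARD('m) ^ CARD('c) * (real CARD('n) * exp (- \<epsilon>\<^sup>2 / (2 * D)))"
proof -
  define N where "N = real CARD('m)"
  define c where "c = real CARD('c)"
  define \<mu> where "\<mu> = coherence Q"
  define \<tau> where "\<tau> = lev_tau Q"
  define \<sigma>2 where "\<sigma>2 = N / c * \<tau>"
  \<comment> \<open>Bernstein's choice of parameter: (m/c) \<mu> is the largest norm of a summand
    and \<open>\<sigma>2\<close> bounds the variance, so 1 - y/3 becomes
    \<open>\<sigma>2 / D\<close>, and \<open>K\<close> is the resulting constant of the quadratic
    term.\<close>
  define \<theta> where "\<theta> = \<epsilon> / D"
  define K where "K = D / (2 * \<sigma>2)"
  define y where "y = \<theta> * (N / c) * \<mu>"
  define Y where "Y j = (s * \<theta> * (N / c)) *\<^sub>R outer (row j Q)" for j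
  \<comment> \<open>The factor \<open>N\<close> appears because the sum over the rows is not
    averaged; the divisor \<open>c\<close> in the exponent cancels in the c-th power.\<close>
  define r where "r = N * exp (s * \<theta> / c + K * \<theta>\<^sup>2 * \<sigma>2 / c)"
  have [simp]: "0 < N" "0 < c" "0 \<le> N" "0 \<le> c"
    by (simp_all add: N_def c_def)
  have pos: "0 < \<mu>" "0 < \<tau>"
    using coherence_pos_lev_tau_pos[OF Q] by (simp_all add: \<mu>_def \<tau>_def)
  then have \<sigma>2: "0 < \<sigma>2" by (simp add: \<sigma>2_def)
  have D: "D = \<sigma>2 + N / c * \<mu> * \<epsilon> / 3"
    by (simp add: D_def \<sigma>2_def N_def c_def \<mu>_def \<tau>_def algebra_simps)
  have "0 < N / c * \<mu> * \<epsilon> / 3"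
    using pos \<open>0 < \<epsilon>\<close> by simp
  with \<sigma>2 D have Dpos: "0 < D" by linarith
  have \<theta>: "0 < \<theta>" using Dpos \<open>0 < \<epsilon>\<close> by (simp add: \<theta>_def)
  have "1 - y / 3 = (D - N / c * \<mu> * \<epsilon> / 3) / D"
    using Dpos by (simp add: y_def \<theta>_def field_simps)
  then have y: "1 - y / 3 = \<sigma>2 / D"
    by (simp add: D)
  then have "y < 3"
    using \<sigma>2 Dpos divide_pos_pos[of \<sigma>2 D] by linarith
  have K: "1 / (2 * (1 - y / 3)) = K"
    unfolding y K_def using Dpos by simp
  have "0 \<le> K" using \<sigma>2 Dpos by (simp add: K_def)
  have s2: "s\<^sup>2 = 1"
    using s power2_abs[of s] by simp
  \<comment> \<open>The Bernstein bound divided by the leverage score. The sign \<open>s\<close>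
    survives only in the linear term, as its square is 1; a row of score 0 contributes 0 on both
    sides.\<close>
  have exp_row: "(exp (s * \<theta> * (N / c) * leverage Q j) - 1) / leverage Q j * (row j Q \<bullet> v)\<^sup>2
      \<le> (s * \<theta> * (N / c) + K * (\<theta> * (N / c))\<^sup>2 * leverage Q j) * (row j Q \<bullet> v)\<^sup>2" for j v
  proof (cases "leverage Q j = 0")
    case True
    then show ?thesis
      using row_inner_power2_le[of j Q v] by simp
  next
    case False
    then have lev: "0 < leverage Q j" by (simp add: leverage_def)
    define x where "x = s * \<theta> * (N / c) * leverage Q j"
    have "\<bar>x\<bar> = \<theta> * (N / c) * leverage Q j"
      using s \<theta> lev by (simp add: x_def abs_mult abs_of_pos)
    also have "\<dots> \<le> y"
      unfolding y_def \<mu>_def using \<theta> by (intro mult_left_mono coherence_ge) simp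
    finally have "exp x \<le> 1 + x + x\<^sup>2 / (2 * (1 - y / 3))"
      using \<open>y < 3\<close> by (rule exp_le_Bernstein)
    also have "x\<^sup>2 / (2 * (1 - y / 3)) = K * x\<^sup>2"
      unfolding K[symmetric] by simp
    also have "x\<^sup>2 = (\<theta> * (N / c))\<^sup>2 * (leverage Q j)\<^sup>2"
      by (simp add: x_def power_mult_distrib power_divide s2)
    finally have "exp x - 1 \<le> (s * \<theta> * (N / c) + K * (\<theta> * (N / c))\<^sup>2 * leverage Q j) * leverage Q j"
      by (simp add: x_def power2_eq_square algebra_simps)
    then show ?thesis
      using lev by (intro mult_right_mono) (simp_all add: divide_le_eq x_def)
  qed
  have r: "v \<bullet> app (\<Sum>j\<in>UNIV. exp (Y j)) v \<le> r * (v \<bullet> v)" for v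
  proof -
    have "v \<bullet> app (\<Sum>j\<in>UNIV. exp (Y j)) v =
        (\<Sum>j\<in>UNIV. v \<bullet> v + (exp (s * \<theta> * (N / c) * leverage Q j) - 1) / leverage Q j * (row j Q \<bullet> v)\<^sup>2)"
      by (simp only: app_sum inner_sum_right Y_def inner_app_exp_outer leverage_row)
    also have "\<dots> \<le> (\<Sum>j\<in>UNIV. v \<bullet> v +
        (s * \<theta> * (N / c) + K * (\<theta> * (N / c))\<^sup>2 * leverage Q j) * (row j Q \<bullet> v)\<^sup>2)"
      by (intro sum_mono add_left_mono exp_row)
    also have "\<dots> = N * (v \<bullet> v) + s * \<theta> * (N / c) * (\<Sum>j\<in>UNIV. (row j Q \<bullet> v)\<^sup>2) +
        K * (\<theta> * (N / c))\<^sup>2 * (\<Sum>j\<in>UNIV. leverage Q j * (row j Q \<bullet> v)\<^sup>2)"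
      by (simp add: distrib_right sum.distrib sum_distrib_left N_def mult.assoc)
    also have "\<dots> \<le> N * (v \<bullet> v) + s * \<theta> * (N / c) * (v \<bullet> v) +
        K * (\<theta> * (N / c))\<^sup>2 * (\<tau> * (v \<bullet> v))"
      unfolding sum_row_inner_power2[OF Q] \<tau>_def using \<open>0 \<le> K\<close>
      by (intro add_left_mono mult_left_mono sum_leverage_row_inner_le Q) simp
    also have "\<dots> = N * (1 + (s * \<theta> / c + K * \<theta>\<^sup>2 * \<sigma>2 / c)) * (v \<bullet> v)"
      by (simp add: \<sigma>2_def field_simps power2_eq_square)
    also have "\<dots> \<le> r * (v \<bullet> v)"
      unfolding r_def by (intro mult_right_mono mult_left_mono exp_ge_add_one_self) simp_all
    finally show ?thesis .
  qed
  have quad: "(\<Sum>i\<in>UNIV. v \<bullet> app (Y (f i)) v) = \<theta> * (s * (norm ((sampling_matrix f ** Q) *v v))\<^sup>2)"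
    for f :: "'c \<Rightarrow> 'm" and v
    unfolding norm_sampling_matrix_mult sum_distrib_left
    by (intro sum.cong) (simp_all add: Y_def app_outer N_def c_def power2_eq_square inner_commute)
  have "real (card {f :: 'c \<Rightarrow> 'm. \<exists>v. v \<bullet> v = 1 \<and>
        \<theta> * (s * (1 + s * \<epsilon>)) \<le> (\<Sum>i\<in>UNIV. v \<bullet> app (Y (f i)) v)}) * exp (\<theta> * (s * (1 + s * \<epsilon>)))
      \<le> r ^ CARD('c) * real CARD('n)"
    by (rule card_large_quadratic_form_le[OF _ _ r]) (simp_all add: Y_def r_def)
  also have "r ^ CARD('c) = N ^ CARD('c) * exp (s * \<theta> + K * \<theta>\<^sup>2 * \<sigma>2)"
    by (simp add: r_def power_mult_distrib c_def algebra_simps flip: exp_of_nat_mult)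
  finally have "real (card {f :: 'c \<Rightarrow> 'm. \<exists>v. v \<bullet> v = 1 \<and>
        s * (1 + s * \<epsilon>) \<le> s * (norm ((sampling_matrix f ** Q) *v v))\<^sup>2})
      \<le> N ^ CARD('c) * exp (s * \<theta> + K * \<theta>\<^sup>2 * \<sigma>2) * real CARD('n) / exp (\<theta> * (s * (1 + s * \<epsilon>)))"
    unfolding quad using \<theta> by (simp add: le_divide_eq)
  also have "\<dots> = N ^ CARD('c) * (real CARD('n) * exp (s * \<theta> + K * \<theta>\<^sup>2 * \<sigma>2 - \<theta> * (s * (1 + s * \<epsilon>))))"
    by (simp add: exp_diff)
  also have "s * \<theta> + K * \<theta>\<^sup>2 * \<sigma>2 - \<theta> * (s * (1 + s * \<epsilon>)) = K * \<theta>\<^sup>2 * \<sigma>2 - \<theta> * \<epsilon> * s\<^sup>2"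
    by (simp add: algebra_simps power2_eq_square)
  \<comment> \<open>The quadratic term equals \<epsilon>^2 / (2 D), half of \<theta> \<epsilon> =
    \<epsilon>^2 / D.\<close>
  also have "\<dots> = - \<epsilon>\<^sup>2 / (2 * D)"
    unfolding s2 using Dpos \<sigma>2 by (simp add: K_def \<theta>_def field_simps power2_eq_square)
  finally show ?thesis by (simp add: N_def)
qed

section \<open>From the two deviation bounds to the probability\<close>

theorem corollary5p6:
  fixes Q :: "real^'n^'m"
    and M :: "'w measure"
    and k :: "'c::finite \<Rightarrow> 'w \<Rightarrow> 'm"
    and \<epsilon> \<delta> :: real
  assumes "transpose Q ** Q = mat 1"
    and "CARD('n) \<le> CARD('c)" and "CARD('c) \<le> CARD('m)"
    and "uniform_sampling M k"
    and "0 < \<epsilon>" and "\<epsilon> < 1" and "0 < \<delta>" and "\<delta> < 1"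
    and "real CARD('c) \<ge> 2 / 3 * real CARD('m) * (3 * lev_tau Q + \<epsilon> * coherence Q) *
           (ln (2 * real CARD('n) / \<delta>) / \<epsilon>\<^sup>2)"
  shows "\<P>(\<omega> in M.
           rank (sampling_matrix (\<lambda>i. k i \<omega>) ** Q) = CARD('n) \<and>
           cond2 (sampling_matrix (\<lambda>i. k i \<omega>) ** Q) \<le> sqrt ((1 + \<epsilon>) / (1 - \<epsilon>)))
         \<ge> 1 - \<delta>"
proof -
  define N where "N = real CARD('m) ^ CARD('c)"
  define D where "D = real CARD('m) / real CARD('c) * (lev_tau Q + coherence Q * \<epsilon> / 3)"
  \<comment> \<open>A bound for the probability of one tail; the 2 inside the logarithm pays for
    both tails.\<close>
  define p where "p = real CARD('n) * exp (- \<epsilon>\<^sup>2 / (2 * D))"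
  define A where "A f = sampling_matrix f ** Q" for f :: "'c \<Rightarrow> 'm"
  \<comment> \<open>For s = 1 these samples reach 1 + \<epsilon> on some unit vector; for s = -1
    they fall to 1 - \<epsilon> or below.\<close>
  define B where "B s = {f :: 'c \<Rightarrow> 'm. \<exists>v. v \<bullet> v = 1 \<and> s * (1 + s * \<epsilon>) \<le> s * (norm (A f *v v))\<^sup>2}" for s
  define G where "G f \<longleftrightarrow> rank (A f) = CARD('n) \<and> cond2 (A f) \<le> sqrt ((1 + \<epsilon>) / (1 - \<epsilon>))" for f
  have pos: "0 < coherence Q" "0 < lev_tau Q"
    using coherence_pos_lev_tau_pos[OF assms(1)] .
  have "0 < N" by (simp add: N_def)
  have Dpos: "0 < D"
    using pos \<open>0 < \<epsilon>\<close> by (simp add: D_def add_pos_pos)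
  \<comment> \<open>The hypothesis on \<open>c\<close> rearranged: 3 \<tau> + \<epsilon> \<mu> is
    three times the bracket in \<open>D\<close>.\<close>
  have "ln (2 * real CARD('n) / \<delta>) * (2 * D) \<le> \<epsilon>\<^sup>2"
  proof -
    have "real CARD('c) * \<epsilon>\<^sup>2 \<ge> 2 / 3 * real CARD('m) * (3 * lev_tau Q + \<epsilon> * coherence Q) *
        ln (2 * real CARD('n) / \<delta>)"
      using assms(9) \<open>0 < \<epsilon>\<close> by (simp add: divide_le_eq)
    then show ?thesis
      by (simp add: D_def field_simps)
  qed
  then have "ln (2 * real CARD('n) / \<delta>) \<le> \<epsilon>\<^sup>2 / (2 * D)"
    using Dpos by (simp add: le_divide_eq)
  then have "exp (ln (2 * real CARD('n) / \<delta>)) \<le> exp (\<epsilon>\<^sup>2 / (2 * D))"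
    by (simp only: exp_le_cancel_iff)
  then have "2 * real CARD('n) / \<delta> \<le> exp (\<epsilon>\<^sup>2 / (2 * D))"
    using \<open>0 < \<delta>\<close> by (subst (asm) exp_ln) simp_all
  then have p: "2 * p \<le> \<delta>"
    using \<open>0 < \<delta>\<close> by (simp add: p_def exp_minus divide_le_eq field_simps)
  have B: "real (card (B s)) \<le> N * p" if "\<bar>s\<bar> = 1" for s
    unfolding B_def N_def p_def A_def D_def by (rule card_deviation_le[OF assms(1) that assms(5)])
  have good: "G f" if f: "f \<notin> B 1 \<union> B (- 1)" for f
  proof -
    \<comment> \<open>Outside both bad sets the bounds hold on unit vectors, and by homogeneity on
      all vectors.\<close>
    have "(1 - \<epsilon>) * (norm v)\<^sup>2 \<le> (norm (A f *v v))\<^sup>2 \<and> (norm (A f *v v))\<^sup>2 \<le> (1 + \<epsilon>) * (norm v)\<^sup>2" for v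
    proof (cases "v = 0")
      case False
      define u where "u = v /\<^sub>R norm v"
      have "u \<bullet> u = 1"
        using False by (simp add: u_def dot_square_norm power2_eq_square)
      then have "(norm (A f *v u))\<^sup>2 \<le> 1 + \<epsilon>" "1 - \<epsilon> \<le> (norm (A f *v u))\<^sup>2"
        using f by (force simp: B_def)+
      moreover have "(norm (A f *v v))\<^sup>2 = (norm (A f *v u))\<^sup>2 * (norm v)\<^sup>2"
        using False by (simp add: u_def matrix_vector_mult_scaleR power_mult_distrib power_inverse)
      ultimately show ?thesis
        by (simp add: mult_right_mono)
    qed simp
    then show ?thesis
      unfolding G_def using \<open>\<epsilon> < 1\<close> by (intro rank_cond2_bound) auto
  qed
  \<comment> \<open>The union bound, in counting form.\<close>
  have "N = real (card (UNIV :: ('c \<Rightarrow> 'm) set))"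
    by (simp add: N_def card_fun)
  also have "\<dots> \<le> real (card ({f. G f} \<union> (B 1 \<union> B (- 1))))"
    using good by (intro of_nat_mono card_mono) auto
  also have "\<dots> \<le> real (card {f. G f}) + (real (card (B 1)) + real (card (B (- 1))))"
    unfolding of_nat_add[symmetric] of_nat_le_iff
    by (intro order_trans[OF card_Un_le] add_left_mono card_Un_le)
  also have "\<dots> \<le> real (card {f. G f}) + (N * p + N * p)"
    by (intro add_mono B order_refl) simp_all
  finally have "N * (1 - 2 * p) \<le> real (card {f. G f})"
    by (simp add: algebra_simps)
  then have "1 - 2 * p \<le> real (card {f. G f}) / N"
    using \<open>0 < N\<close> by (simp add: le_divide_eq mult.commute)
  moreover have "\<P>(\<omega> in M. G (\<lambda>i. k i \<omega>)) = real (card {f. G f}) / N"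
    unfolding N_def by (rule uniform_sampling_prob[OF assms(4)])
  ultimately show ?thesis
    using p by (simp add: G_def A_def)
qed

end
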